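(* For all positive integers $s$, $k$ and $n$, \[ \frac{J_k(n)}{n^k}\,\zeta(s+k) \;=\; \sum_{q=1}^{\infty} \frac{\mu(q)}{J_{s+k}(q)}\, c_q^s(n^s), \] where the series on the right converges.
   Context: For positive integers $m,n$ and $s$, the generalized GCD $(m,n)_s$ is the largest positive integer of the form $l^s$ with $l\in\mathbb{N}$ such that $l^s\mid m$ and $l^s\mid n$. For positive integers $r,s$ and an integer $n$, the Cohen-Ramanujan sum is \[ c_r^s(n) := \sum_{\substack{h=1\\ (h,r^s)_s=1}}^{r^s} e^{2\pi i n h / r^s}. \] The Jordan totient function is $J_k(n) = n^k\prod_{p\mid n,\ p \text{ prime}}\left(1-\frac{1}{p^k}\right)$ (the number of ordered $k$-tuples of elements of a complete residue system mod $n$ whose gcd together with $n$ is $1$). $\mu$ denotes the Möbius function and $\zeta$ the Riemann zeta function. *)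

theory Defs
  imports
    "HOL-Analysis.Analysis"
    "HOL-Computational_Algebra.Squarefree"
begin

definition gen_gcd :: "nat \<Rightarrow> nat \<Rightarrow> nat \<Rightarrow> nat" where
  "gen_gcd s m n = Max {l ^ s | l. l > 0 \<and> l ^ s dvd m \<and> l ^ s dvd n}"

definition cohen_ramanujan_sum :: "nat \<Rightarrow> nat \<Rightarrow> int \<Rightarrow> complex" where
  "cohen_ramanujan_sum s r n =
     (\<Sum>h | h \<in> {1..r ^ s} \<and> gen_gcd s h (r ^ s) = 1.
        exp (2 * of_real pi * \<i> * of_int n * of_nat h / of_nat (r ^ s)))"

definition jordan_totient :: "nat \<Rightarrow> nat \<Rightarrow> real" where
  "jordan_totient k n = real n ^ k * (\<Prod>p\<in>prime_factors n. 1 - 1 / real p ^ k)"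

definition moebius_mu :: "nat \<Rightarrow> int" where
  "moebius_mu n = (if squarefree n then (-1) ^ card (prime_factors n) else 0)"

text \<open>
  The Riemann zeta function on the half-plane \<open>Re z > 1\<close>, where its Dirichlet series
  converges. Outside that half-plane the value below is not that of the analytic continuation.
\<close>
definition riemann_zeta :: "complex \<Rightarrow> complex" where
  "riemann_zeta z = (\<Sum>m. 1 / of_nat (Suc m) powr z)"

end

theory Submission
  imports Defs
begin

text \<open>
  The terms of the series vanish unless \<open>q\<close> is squarefree, and they are multiplicative there.
  Grouping the fractions \<open>h / q\<^sup>s\<close> by reduced form gives
  \<open>(\<Sum>d | d dvd q. c d) = (if q dvd n then q\<^sup>s else 0)\<close> for \<open>c d = c\<^sub>d\<^sup>s(n\<^sup>s)\<close>, so for squarefree \<open>q\<close> the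
  Cohen-Ramanujan sum is the product over the primes \<open>p\<close> dividing \<open>q\<close> of \<open>p\<^sup>s - 1\<close> (if \<open>p\<close>
  divides \<open>n\<close>) or \<open>-1\<close> (otherwise). With \<open>t = s + k\<close>, the series therefore has an Euler product
  with factors \<open>1 / (1 - 1/p\<^sup>t)\<close>, multiplied by \<open>1 - 1/p\<^sup>k\<close> when \<open>p\<close> divides \<open>n\<close>. The first factors
  multiply to \<open>\<zeta>(t)\<close>, by sieving the multiples of the primes up to \<open>N\<close> out of its Dirichlet series,
  and the second ones to \<open>J\<^sub>k(n) / n\<^sup>k\<close>.
\<close>

section \<open>Squarefree numbers as finite sets of primes\<close>

lemma squarefree_prod_primes:
  fixes X :: "nat set"
  assumes "finite X" and "\<And>p. p \<in> X \<Longrightarrow> prime p"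
  shows "squarefree (\<Prod>X)" and "prime_factors (\<Prod>X) = X"
proof -
  show "squarefree (\<Prod>X)"
    using assms by (intro squarefree_prod_coprime) (auto intro: primes_coprime squarefree_prime)
  have "\<Prod>X \<noteq> 0"
    using assms(2)[of 0] by (auto simp: prod_zero_iff[OF assms(1)])
  then have "prime_factors (\<Prod>X) = {p. prime p \<and> (\<exists>x\<in>X. p dvd x)}"
    using assms(1) by (auto simp: prime_factors_dvd prime_dvd_prod_iff)
  also have "\<dots> = X"
  proof (intro equalityI subsetI)
    fix p assume "p \<in> {p. prime p \<and> (\<exists>x\<in>X. p dvd x)}"
    then obtain x where "prime p" "x \<in> X" "p dvd x" by blast
    then show "p \<in> X" using primes_dvd_imp_eq[of p x] assms(2) by simp
  next
    fix p assume "p \<in> X"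
    with assms(2) dvd_refl[of p] show "p \<in> {p. prime p \<and> (\<exists>x\<in>X. p dvd x)}" by blast
  qed
  finally show "prime_factors (\<Prod>X) = X" .
qed

lemma prod_prime_factors_squarefree:
  fixes q :: nat
  assumes "squarefree q"
  shows "\<Prod>(prime_factors q) = q"
proof -
  have "q \<noteq> 0" using assms by (metis not_squarefree_0)
  then have "q = (\<Prod>p\<in>prime_factors q. p ^ multiplicity p q)"
    using prod_prime_factors[of q] by simp
  also have "\<dots> = \<Prod>(prime_factors q)"
    using assms \<open>q \<noteq> 0\<close> by (intro prod.cong) (auto simp: squarefree_factorial_semiring')
  finally show ?thesis by simp
qed

text \<open>A squarefree number is the product of its prime factors, so \<open>prime_factors\<close>
  inverts the product map on sets of primes.\<close>

lemma bij_betw_prod_primes_squarefree: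
  fixes P :: "nat set"
  assumes "finite P" and "\<And>p. p \<in> P \<Longrightarrow> prime p"
  shows "bij_betw \<Prod> (Pow P) {q. squarefree q \<and> prime_factors q \<subseteq> P}"
proof (rule bij_betw_byWitness[where f' = prime_factors])
  have "squarefree (\<Prod>X)" "prime_factors (\<Prod>X) = X" if "X \<subseteq> P" for X
    using squarefree_prod_primes[of X] that assms by (auto intro: finite_subset)
  then show "\<forall>X\<in>Pow P. prime_factors (\<Prod>X) = X"
    and "\<Prod> ` Pow P \<subseteq> {q. squarefree q \<and> prime_factors q \<subseteq> P}"
    by auto
qed (auto simp: prod_prime_factors_squarefree)

lemma finite_squarefree_prime_factors_subset:
  fixes P :: "nat set"
  assumes "finite P" and "\<And>p. p \<in> P \<Longrightarrow> prime p"
  shows "finite {q. squarefree q \<and> prime_factors q \<subseteq> P}"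
  using bij_betw_finite[OF bij_betw_prod_primes_squarefree[OF assms]] assms(1) by simp

text \<open>Expanding the right-hand product gives one term for each subset of \<open>P\<close>, and
  these subsets correspond to the \<open>q\<close> on the left. The ring is kept general because the
  identity serves both real Euler products and complex divisor sums.\<close>

lemma sum_squarefree_prod:
  fixes a :: "nat \<Rightarrow> 'a :: comm_ring_1" and P :: "nat set"
  assumes "finite P" and "\<And>p. p \<in> P \<Longrightarrow> prime p"
  shows "(\<Sum>q | squarefree q \<and> prime_factors q \<subseteq> P. \<Prod>p\<in>prime_factors q. a p) = (\<Prod>p\<in>P. 1 + a p)"
proof -
  have "(\<Prod>p\<in>P. 1 + a p) = (\<Sum>X\<in>Pow P. prod a X)"
    using prod_add[OF assms(1), of a "\<lambda>_. 1"] by (simp add: add.commute)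
  also have "\<dots> = (\<Sum>X\<in>Pow P. prod a (prime_factors (\<Prod>X)))"
  proof (intro sum.cong refl)
    fix X assume "X \<in> Pow P"
    then have "prime_factors (\<Prod>X) = X"
      using assms by (intro squarefree_prod_primes(2)) (auto intro: finite_subset)
    then show "prod a X = prod a (prime_factors (\<Prod>X))" by simp
  qed
  also have "\<dots> = (\<Sum>q | squarefree q \<and> prime_factors q \<subseteq> P. \<Prod>p\<in>prime_factors q. a p)"
    by (rule sum.reindex_bij_betw[OF bij_betw_prod_primes_squarefree[OF assms],
          of "\<lambda>q. prod a (prime_factors q)"])
  finally show ?thesis by simp
qed

section \<open>Euler products over squarefree numbers\<close>

lemma finite_primes_le: "finite {p::nat. prime p \<and> p \<le> N}"
  by (rule finite_subset[of _ "{..N}"]) auto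

text \<open>Finite sums of absolute values stay below the exponential of the sum of all
  \<open>\<bar>a p\<bar>\<close>, so the unordered sum exists. Its value is then read off along
  finite sets whose sums are exactly the partial Euler products.\<close>

lemma squarefree_has_sum_euler_product:
  fixes a :: "nat \<Rightarrow> real"
  assumes a: "summable (\<lambda>p. \<bar>a p\<bar>)"
    and L: "(\<lambda>N. \<Prod>p | prime p \<and> p \<le> N. 1 + a p) \<longlonglongrightarrow> L"
  shows "((\<lambda>q. \<Prod>p\<in>prime_factors q. a p) has_sum L) {q. squarefree q}"
proof -
  \<comment> \<open>These finite sets contain every squarefree number up to \<open>N\<close>, along
    with larger ones built from the same primes.\<close>
  define B where "B N = {q. squarefree q \<and> prime_factors q \<subseteq> {p::nat. prime p \<and> p \<le> N}}" for N
  let ?g = "\<lambda>q. \<Prod>p\<in>prime_factors q. a p"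
  have fin: "finite (B N)" for N
    unfolding B_def by (rule finite_squarefree_prime_factors_subset) (auto simp: finite_primes_le)
  have sumB: "(\<Sum>q\<in>B N. \<Prod>p\<in>prime_factors q. b p) = (\<Prod>p | prime p \<and> p \<le> N. 1 + b p)"
    for N and b :: "nat \<Rightarrow> real"
    unfolding B_def by (rule sum_squarefree_prod) (auto simp: finite_primes_le)
  have sub: "X \<subseteq> B N" if "X \<subseteq> {q. squarefree q}" "X \<subseteq> {..N}" for X N
  proof
    fix q assume q: "q \<in> X"
    then have "squarefree q" using that by auto
    then have "q \<noteq> 0" by (metis not_squarefree_0)
    then have "p \<le> N" if "p \<in> prime_factors q" for p
      using dvd_imp_le[of p q] that q \<open>X \<subseteq> {..N}\<close> by force
    then show "q \<in> B N" using \<open>squarefree q\<close> by (auto simp: B_def)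
  qed
  \<comment> \<open>The sets \<open>B N\<close> eventually contain any given finite set of
    squarefree numbers, so a limit over all finite subsets may be computed along them.\<close>
  have lim: "filterlim B (finite_subsets_at_top {q. squarefree q}) sequentially"
    unfolding filterlim_finite_subsets_at_top
  proof (intro allI impI)
    fix X :: "nat set" assume X: "finite X \<and> X \<subseteq> {q. squarefree q}"
    show "\<forall>\<^sub>F N in sequentially. finite (B N) \<and> X \<subseteq> B N \<and> B N \<subseteq> {q. squarefree q}"
      using eventually_ge_at_top[of "Max (insert 0 X)"]
    proof eventually_elim
      case (elim N)
      then have "X \<subseteq> {..N}" using X by auto
      then show ?case using sub[of X N] fin X by (auto simp: B_def)
    qed
  qed
  have "(\<lambda>q. norm (?g q)) summable_on {q. squarefree q}"
  proof (rule nonneg_bdd_above_summable_on)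
    show "bdd_above (sum (\<lambda>q. norm (?g q)) ` {F. F \<subseteq> {q. squarefree q} \<and> finite F})"
    proof (rule bdd_aboveI2)
      fix F :: "nat set" assume "F \<in> {F. F \<subseteq> {q. squarefree q} \<and> finite F}"
      then have F: "F \<subseteq> {q. squarefree q}" "finite F" by auto
      \<comment> \<open>The inserted \<open>0\<close> keeps the maximum meaningful for empty
        \<open>F\<close>.\<close>
      define N where "N = Max (insert 0 F)"
      have "F \<subseteq> {..N}" using F by (auto simp: N_def)
      then have "(\<Sum>q\<in>F. norm (?g q)) \<le> (\<Sum>q\<in>B N. \<Prod>p\<in>prime_factors q. \<bar>a p\<bar>)"
        using fin sub[of F N] F(1) by (simp add: abs_prod sum_mono2 prod_nonneg)
      also have "\<dots> = (\<Prod>p | prime p \<and> p \<le> N. 1 + \<bar>a p\<bar>)" by (rule sumB)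
      also have "\<dots> \<le> exp (\<Sum>p | prime p \<and> p \<le> N. \<bar>a p\<bar>)"
        by (rule prod_le_exp_sum) auto
      also have "\<dots> \<le> exp (\<Sum>p. \<bar>a p\<bar>)"
        using a by (auto intro!: sum_le_suminf simp: finite_primes_le)
      finally show "(\<Sum>q\<in>F. norm (?g q)) \<le> exp (\<Sum>p. \<bar>a p\<bar>)" .
    qed
  qed auto
  then have "?g summable_on {q. squarefree q}" by (rule abs_summable_summable)
  then obtain L' where L': "(?g has_sum L') {q. squarefree q}" 
    by (auto simp: summable_on_def)
  have "(\<lambda>N. \<Sum>q\<in>B N. ?g q) \<longlonglongrightarrow> L'"
    using filterlim_compose[OF L'[unfolded has_sum_def] lim] by simp
  then have "L' = L"
    unfolding sumB using L by (rule LIMSEQ_unique)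
  with L' show ?thesis by simp
qed

section \<open>Euler product of the zeta function\<close>

text \<open>One sieving step: among the numbers free of primes in \<open>P\<close>, the multiples of
  a new prime \<open>p\<close> are \<open>p\<close> times that same set. They contribute the
  fraction \<open>1 / p ^ t\<close> of the sum, and removing them multiplies it by
  \<open>1 - 1 / p ^ t\<close>.\<close>

lemma has_sum_inverse_power_coprime:
  fixes P :: "nat set" and Z :: real
  assumes "finite P" and "\<And>p. p \<in> P \<Longrightarrow> prime p"
    and Z: "((\<lambda>m. 1 / real m ^ t) has_sum Z) {0<..}"
  shows "((\<lambda>m. 1 / real m ^ t) has_sum Z * (\<Prod>p\<in>P. 1 - 1 / real p ^ t)) {m. m > 0 \<and> (\<forall>p\<in>P. \<not> p dvd m)}"
  using assms(1,2)
proof (induction P rule: finite_induct)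
  case empty
  then show ?case using Z by (simp add: greaterThan_def)
next
  case (insert p P)
  let ?A = "{m::nat. m > 0 \<and> (\<forall>p\<in>P. \<not> p dvd m)}"
  let ?S = "Z * (\<Prod>p\<in>P. 1 - 1 / real p ^ t)"
  have p: "prime p" using insert.prems by auto
  have IH: "((\<lambda>m. 1 / real m ^ t) has_sum ?S) ?A" using insert by auto
  have "((\<lambda>m. 1 / real p ^ t * (1 / real m ^ t)) has_sum 1 / real p ^ t * ?S) ?A"
    by (rule has_sum_cmult_right[OF IH])
  then have "((\<lambda>m. 1 / real m ^ t) \<circ> (\<lambda>m. p * m) has_sum 1 / real p ^ t * ?S) ?A"
    by (simp add: o_def power_mult_distrib)
  moreover have "inj_on (\<lambda>m. p * m) ?A" using p by (auto simp: inj_on_def)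
  ultimately have *: "((\<lambda>m. 1 / real m ^ t) has_sum 1 / real p ^ t * ?S) ((\<lambda>m. p * m) ` ?A)"
    by (simp add: has_sum_reindex)
  have dvd: "r dvd p * m \<longleftrightarrow> r dvd m" if "r \<in> P" for r m
  proof -
    have "prime r" "r \<noteq> p" using insert that by auto
    then show ?thesis using p by (auto simp: prime_dvd_mult_iff dest: primes_dvd_imp_eq)
  qed
  have sub: "(\<lambda>m. p * m) ` ?A \<subseteq> ?A" using p dvd by (auto simp: prime_gt_0_nat)
  have "?A - (\<lambda>m. p * m) ` ?A = {m. m > 0 \<and> (\<forall>p\<in>insert p P. \<not> p dvd m)}"
    using dvd by (auto elim!: dvdE)
  then show ?case
    using has_sum_Diff[OF IH * sub] insert.hyps by (simp add: algebra_simps)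
qed

lemma prime_power_gt_1: "prime (p::nat) \<Longrightarrow> t > 0 \<Longrightarrow> real p ^ t > 1"
  using prime_gt_1_nat[of p] by (simp add: one_less_power)

text \<open>Sieving by the primes up to \<open>N\<close> leaves the term at \<open>1\<close> and
  terms beyond \<open>N\<close> only. Hence \<open>Z * D N - 1\<close> lies between \<open>0\<close>
  and a tail of the zeta series.\<close>

lemma euler_product_zeta_real:
  assumes t: "t \<ge> 2"
  shows "(\<lambda>N. \<Prod>p | prime p \<and> p \<le> N. 1 / (1 - 1 / real p ^ t)) \<longlonglongrightarrow> (\<Sum>m. 1 / real (Suc m) ^ t)"
proof -
  let ?f = "\<lambda>m::nat. 1 / real m ^ t"
  define Z where "Z = (\<Sum>m. 1 / real (Suc m) ^ t)"
  have "summable (\<lambda>m. 1 / real m ^ t)"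
    using inverse_power_summable[OF t, where ?'a = real] by (simp add: field_simps)
  then have "summable (\<lambda>m. 1 / real (Suc m) ^ t)" by (subst summable_Suc_iff)
  then have sums: "(\<lambda>m. 1 / real (Suc m) ^ t) sums Z" unfolding Z_def by (rule summable_sums)
  have "((\<lambda>m. 1 / real (Suc m) ^ t) has_sum Z) UNIV"
    by (rule sums_nonneg_imp_has_sum[OF sums]) auto
  then have Z: "(?f has_sum Z) {0<..}"
    using has_sum_reindex[of Suc UNIV ?f Z] by (simp add: o_def greaterThan_0)
  define D where "D N = (\<Prod>p | prime p \<and> p \<le> N. 1 - 1 / real p ^ t)" for N
  have upper: "Z * D N - 1 \<le> Z - (\<Sum>m<N. 1 / real (Suc m) ^ t)" and lower: "0 \<le> Z * D N - 1"
    if N: "N > 0" for N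
  proof -
    let ?A = "{m::nat. m > 0 \<and> (\<forall>p\<in>{p. prime p \<and> p \<le> N}. \<not> p dvd m)}"
    have "(?f has_sum Z * D N) ?A"
      unfolding D_def by (rule has_sum_inverse_power_coprime[OF _ _ Z]) (auto simp: finite_primes_le)
    moreover have "(?f has_sum 1) {1}" using has_sum_finite[of "{1::nat}" ?f] by simp
    moreover have "{1} \<subseteq> ?A" by auto
    ultimately have 1: "(?f has_sum Z * D N - 1) (?A - {1})" by (rule has_sum_Diff)
    then show "0 \<le> Z * D N - 1" by (rule has_sum_nonneg) auto
    have "(?f has_sum sum ?f {1..N}) {1..N}" by (rule has_sum_finite) auto
    then have 2: "(?f has_sum Z - sum ?f {1..N}) ({0<..} - {1..N})"
      by (rule has_sum_Diff[OF Z]) auto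
    \<comment> \<open>A survivor other than \<open>1\<close> has a prime factor, which must exceed
      \<open>N\<close>.\<close>
    have "?A - {1} \<subseteq> {0<..} - {1..N}"
    proof
      fix m assume m: "m \<in> ?A - {1}"
      then obtain p where "prime p" "p dvd m" using prime_factor_nat[of m] by auto
      moreover from this have "p \<le> m" using m by (auto dest: dvd_imp_le)
      ultimately show "m \<in> {0<..} - {1..N}" using m by force
    qed
    then have "Z * D N - 1 \<le> Z - sum ?f {1..N}"
      by (rule has_sum_mono2[OF 1 2]) auto
    also have "sum ?f {1..N} = (\<Sum>m<N. 1 / real (Suc m) ^ t)"
      by (rule sum.reindex_bij_witness[of _ Suc "\<lambda>i. i - 1"]) auto
    finally show "Z * D N - 1 \<le> Z - (\<Sum>m<N. 1 / real (Suc m) ^ t)" .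
  qed
  have "(\<lambda>N. Z - (\<Sum>m<N. 1 / real (Suc m) ^ t)) \<longlonglongrightarrow> Z - Z"
    using sums unfolding sums_def by (intro tendsto_intros)
  then have "(\<lambda>N. Z * D N - 1) \<longlonglongrightarrow> 0"
    by (intro tendsto_sandwich[OF eventually_mono[OF eventually_gt_at_top[of 0] lower]
          eventually_mono[OF eventually_gt_at_top[of 0] upper]]) auto
  from tendsto_add[OF this tendsto_const[of 1]]
  have ZD: "(\<lambda>N. Z * D N) \<longlonglongrightarrow> 1" by simp
  \<comment> \<open>This permits passing from the limit of \<open>Z * D N\<close> to that of
    \<open>1 / D N\<close>, written as \<open>Z / (Z * D N)\<close>.\<close>
  have "Z \<noteq> 0"
  proof
    assume "Z = 0"
    with ZD have "(\<lambda>N. 0 :: real) \<longlonglongrightarrow> 1" by simp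
    from LIMSEQ_unique[OF this tendsto_const] show False by simp
  qed
  then have "(\<lambda>N. Z / (Z * D N)) \<longlonglongrightarrow> Z / 1"
    by (intro tendsto_divide tendsto_const ZD) auto
  moreover have "Z / (Z * D N) = (\<Prod>p | prime p \<and> p \<le> N. 1 / (1 - 1 / real p ^ t))" for N
    using \<open>Z \<noteq> 0\<close> by (simp add: D_def prod_dividef)
  ultimately show ?thesis by (simp add: Z_def)
qed


section \<open>Reduced fractions and divisor sums of Cohen-Ramanujan sums\<close>

text \<open>Trades the maximum for divisibility: \<open>1\<close> is always a candidate, the
  candidates are bounded by \<open>r ^ s\<close>, and \<open>l ^ s dvd r ^ s\<close> amounts to
  \<open>l dvd r\<close>.\<close>

lemma gen_gcd_power_eq_1_iff:
  assumes "s > 0" and "r > 0"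
  shows "gen_gcd s h (r ^ s) = 1 \<longleftrightarrow> (\<forall>l. l ^ s dvd h \<longrightarrow> l dvd r \<longrightarrow> l = 1)"
proof -
  let ?S = "{l ^ s | l. l > 0 \<and> l ^ s dvd h \<and> l ^ s dvd r ^ s}"
  have "?S \<subseteq> {..r ^ s}" using assms by (auto dest: dvd_imp_le)
  then have fin: "finite ?S" by (rule finite_subset) simp
  have "1 = (1::nat) ^ s" by simp
  then have "1 \<in> ?S" by force
  then have "gen_gcd s h (r ^ s) = 1 \<longleftrightarrow> (\<forall>x\<in>?S. x \<le> 1)"
    unfolding gen_gcd_def using fin Max_eq_iff[of ?S 1] by blast
  also have "\<dots> \<longleftrightarrow> (\<forall>l. l > 0 \<and> l ^ s dvd h \<and> l dvd r \<longrightarrow> l ^ s \<le> 1)"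
    using assms(1) by auto
  also have "\<dots> \<longleftrightarrow> (\<forall>l. l ^ s dvd h \<longrightarrow> l dvd r \<longrightarrow> l = 1)"
  proof -
    have "l ^ s \<le> 1 \<longleftrightarrow> l = 1" if "l > 0" for l :: nat
    proof
      assume "l ^ s \<le> 1"
      moreover have "l \<le> l ^ s" using assms(1) that by (simp add: self_le_power)
      ultimately show "l = 1" using that by linarith
    qed simp
    moreover have "l > 0" if "l dvd r" for l using that assms(2) by (auto intro: Nat.gr0I)
    ultimately show ?thesis by blast
  qed
  finally show ?thesis .
qed

text \<open>Gives uniqueness of reduced forms: the cofactors of two of them divide each other. After
  removing \<open>gcd l e\<close> from both \<open>l\<close> and \<open>e\<close>, the remaining
  factor \<open>a\<close> of \<open>l\<close> satisfies \<open>a dvd d\<close> and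
  \<open>a ^ s dvd h\<close>, so reducedness forces \<open>a = 1\<close>.\<close>

lemma power_dvd_imp_dvd_gen_gcd_part:
  fixes d e l h s :: nat
  assumes "s > 0" and "e > 0" and "d > 0" and cop: "gen_gcd s h (d ^ s) = 1"
    and "l dvd d * e" and "l ^ s dvd h * e ^ s"
  shows "l dvd e"
proof -
  define g where "g = gcd l e"
  have g: "g > 0" using assms(2) by (simp add: g_def)
  obtain a b where ab: "l = a * g" "e = b * g" "coprime a b"
    using gcd_coprime_exists[of l e] g unfolding g_def by auto
  have "a * g dvd (d * b) * g" using assms(5) by (simp add: ab mult_ac)
  then have "a dvd d" using g ab(3) by (simp add: coprime_dvd_mult_left_iff)
  have "a ^ s * g ^ s dvd (h * b ^ s) * g ^ s"
    using assms(6) by (simp add: ab power_mult_distrib mult_ac)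
  then have "a ^ s dvd h" using g ab(3) by (simp add: coprime_dvd_mult_left_iff)
  with \<open>a dvd d\<close> have "a = 1" using cop gen_gcd_power_eq_1_iff[of s d h] assms by blast
  then show ?thesis by (simp add: ab)
qed

text \<open>Each \<open>h / q\<^sup>s\<close> has a unique reduced form \<open>h' / d\<^sup>s\<close> with \<open>d\<close> dividing \<open>q\<close>.\<close>
lemma bij_betw_reduced_power_fractions:
  assumes s: "s > 0" and q: "q > 0"
  shows "bij_betw (\<lambda>(d, h). h * (q div d) ^ s)
           (SIGMA d:{d. d dvd q}. {h \<in> {1..d ^ s}. gen_gcd s h (d ^ s) = 1}) {1..q ^ s}"
    (is "bij_betw ?f ?D _")
proof (rule bij_betw_imageI)
  show "inj_on ?f ?D"
  proof (rule inj_onI)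
    fix x y assume x: "x \<in> ?D" and y: "y \<in> ?D" and xy: "?f x = ?f y"
    obtain d h d' h' where xy_eq: "x = (d, h)" "y = (d', h')" by (cases x, cases y) auto
    have "d dvd q" "d' dvd q" using x y xy_eq by auto
    then obtain e e' where e: "q = d * e" "q = d' * e'" by (meson dvdE)
    have pos: "d > 0" "e > 0" "d' > 0" "e' > 0" using e q by (auto intro!: Nat.gr0I)
    have "q div d = e" using e(1) pos(1) by simp
    moreover have "q div d' = e'" using e(2) pos(3) by simp
    ultimately have eq: "h * e ^ s = h' * e' ^ s" using xy by (simp add: xy_eq)
    have cop: "gen_gcd s h (d ^ s) = 1" "gen_gcd s h' (d' ^ s) = 1" using x y xy_eq by auto
    have "e' dvd d * e" unfolding e(1)[symmetric] e(2) by (rule dvd_triv_right)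
    moreover have "e' ^ s dvd h * e ^ s" unfolding eq by (rule dvd_triv_right)
    ultimately have "e' dvd e"
      using power_dvd_imp_dvd_gen_gcd_part[OF s pos(2,1) cop(1)] by blast
    moreover have "e dvd e'"
    proof (rule power_dvd_imp_dvd_gen_gcd_part[OF s pos(4,3) cop(2)])
      show "e dvd d' * e'" unfolding e(2)[symmetric] e(1) by (rule dvd_triv_right)
      show "e ^ s dvd h' * e' ^ s" unfolding eq[symmetric] by (rule dvd_triv_right)
    qed
    ultimately have "e = e'" by (rule dvd_antisym[rotated])
    moreover from this have "d = d'" using e pos by (metis mult_right_cancel less_not_refl)
    ultimately show "x = y" using eq pos by (simp add: xy_eq)
  qed
  show "?f ` ?D = {1..q ^ s}"
  proof (intro equalityI subsetI)
    fix m assume "m \<in> ?f ` ?D"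
    then obtain d h where dh: "d dvd q" "h \<in> {1..d ^ s}" "m = h * (q div d) ^ s" by auto
    obtain e where e: "q = d * e" using dh by (auto elim: dvdE)
    have pos: "d > 0" "e > 0" using e q by (auto intro!: Nat.gr0I)
    have "m = h * e ^ s" using dh e pos by simp
    moreover have "h * e ^ s \<le> d ^ s * e ^ s" using dh by simp
    ultimately show "m \<in> {1..q ^ s}" using dh pos by (simp add: e power_mult_distrib)
  next
    fix m assume m: "m \<in> {1..q ^ s}"
    \<comment> \<open>For surjectivity, the largest \<open>e\<close> in \<open>E\<close> is
      cancelled: \<open>e ^ s\<close> divides both \<open>m\<close> and
      \<open>q ^ s\<close>.\<close>
    define E where "E = {l. l dvd q \<and> l ^ s dvd m}"
    have finE: "finite E" using q by (auto simp: E_def)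
    have "1 \<in> E" by (simp add: E_def)
    define e where "e = Max E"
    have "e \<in> E" unfolding e_def using finE \<open>1 \<in> E\<close> by (intro Max_in) auto
    then obtain d h where d: "q = e * d" and h: "m = e ^ s * h"
      by (auto simp: E_def elim!: dvdE)
    have pos: "e > 0" "d > 0" "h > 0" using d h q m by (auto intro!: Nat.gr0I)
    have "e ^ s * h \<le> e ^ s * d ^ s" using m by (simp add: h d power_mult_distrib)
    then have "h \<le> d ^ s" using pos by simp
    moreover have "gen_gcd s h (d ^ s) = 1"
      unfolding gen_gcd_power_eq_1_iff[OF s pos(2)]
    proof (intro allI impI)
      fix l assume l: "l ^ s dvd h" "l dvd d"
      \<comment> \<open>A further common factor \<open>l\<close> would put \<open>e * l\<close> into
        \<open>E\<close>, against the maximality of \<open>e\<close>.\<close>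
      then have "e * l \<in> E" by (simp add: E_def d h power_mult_distrib)
      then have "e * l \<le> e" unfolding e_def using finE by simp
      moreover have "l > 0" using l pos by (auto intro!: Nat.gr0I)
      ultimately show "l = 1" using pos by simp
    qed
    ultimately have "(d, h) \<in> ?D" using pos by (auto simp: d)
    moreover have "m = ?f (d, h)" using pos by (simp add: d h mult_ac)
    ultimately show "m \<in> ?f ` ?D" by blast
  qed
qed

text \<open>The exponential depends only on the value of the fraction, so passing to reduced forms
  sorts the full sum by denominator.\<close>

lemma sum_divisors_cohen_ramanujan_sum:
  assumes s: "s > 0" and q: "q > 0"
  shows "(\<Sum>d | d dvd q. cohen_ramanujan_sum s d n) =
    (\<Sum>h=1..q ^ s. exp (2 * of_real pi * \<i> * of_int n * of_nat h / of_nat (q ^ s)))"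
proof -
  let ?C = "\<lambda>d. {h \<in> {1..d ^ s}. gen_gcd s h (d ^ s) = 1}"
  let ?F = "\<lambda>h M. exp (2 * of_real pi * \<i> * of_int n * of_nat h / of_nat M)"
  have "(\<Sum>d | d dvd q. cohen_ramanujan_sum s d n) =
      (\<Sum>(d, h)\<in>(SIGMA d:{d. d dvd q}. ?C d). ?F h (d ^ s))"
    using q by (simp add: cohen_ramanujan_sum_def sum.Sigma)
  also have "\<dots> = (\<Sum>(d, h)\<in>(SIGMA d:{d. d dvd q}. ?C d). ?F (h * (q div d) ^ s) (q ^ s))"
  proof (intro sum.cong refl, clarify)
    fix d h assume "d dvd q"
    then obtain e where e: "q = d * e" by (auto elim: dvdE)
    have "d > 0" "e > 0" using e q by (auto intro!: Nat.gr0I)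
    then show "?F h (d ^ s) = ?F (h * (q div d) ^ s) (q ^ s)"
      by (simp add: e power_mult_distrib mult.assoc)
  qed
  also have "\<dots> = (\<Sum>x\<in>(SIGMA d:{d. d dvd q}. ?C d). ?F ((\<lambda>(d, h). h * (q div d) ^ s) x) (q ^ s))"
    by (intro sum.cong refl) auto
  also have "\<dots> = (\<Sum>h=1..q ^ s. ?F h (q ^ s))"
    by (rule sum.reindex_bij_betw[OF bij_betw_reduced_power_fractions[OF s q], of "\<lambda>h. ?F h (q ^ s)"])
  finally show ?thesis .
qed

section \<open>Cohen-Ramanujan sums at squarefree moduli\<close>

text \<open>A geometric sum over the powers of an \<open>M\<close>-th root of unity
  \<open>w\<close>, where \<open>w = 1\<close> exactly if \<open>M\<close> divides
  \<open>m\<close>.\<close>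

lemma sum_roots_of_unity_powers:
  fixes m M :: nat
  assumes "M > 0"
  shows "(\<Sum>h=1..M. exp (2 * of_real pi * \<i> * of_nat m * of_nat h / of_nat M)) =
    (if M dvd m then of_nat M else 0)"
proof -
  define w where "w = exp (2 * of_real pi * \<i> * of_nat m / of_nat M)"
  have w1: "w = 1 \<longleftrightarrow> M dvd m"
    unfolding w_def using assms by (intro complex_root_unity_eq_1) auto
  have wM: "w ^ M = 1"
    unfolding w_def using assms by (intro complex_root_unity) auto
  have "(\<Sum>h=1..M. exp (2 * of_real pi * \<i> * of_nat m * of_nat h / of_nat M)) = (\<Sum>h=1..M. w ^ h)"
    by (intro sum.cong refl) (simp add: w_def exp_of_nat_mult[symmetric] mult_ac)
  also have "\<dots> = (\<Sum>h<M. w * w ^ h)"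
    by (rule sum.reindex_bij_witness[of _ Suc "\<lambda>i. i - 1"]) (auto simp flip: power_Suc)
  also have "\<dots> = (if M dvd m then of_nat M else 0)"
    using geometric_sum[of w M] w1 wM by (auto simp flip: sum_distrib_left)
  finally show ?thesis .
qed

text \<open>Brings a sum over divisors into the form required by
  \<open>sum_squarefree_prod\<close>.\<close>

lemma divisors_squarefree:
  fixes q :: nat
  assumes "squarefree q"
  shows "{d. d dvd q} = {d. squarefree d \<and> prime_factors d \<subseteq> prime_factors q}"
proof (intro equalityI subsetI)
  fix d assume "d \<in> {d. d dvd q}"
  moreover have "q \<noteq> 0" using assms by (metis not_squarefree_0)
  ultimately show "d \<in> {d. squarefree d \<and> prime_factors d \<subseteq> prime_factors q}"
    using assms by (auto intro: squarefree_mono simp: prime_factors_dvd)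
next
  fix d assume "d \<in> {d. squarefree d \<and> prime_factors d \<subseteq> prime_factors q}"
  then have "\<Prod>(prime_factors d) dvd \<Prod>(prime_factors q)" "squarefree d"
    by (auto intro: prod_dvd_prod_subset)
  then show "d \<in> {d. d dvd q}"
    using assms by (simp add: prod_prime_factors_squarefree)
qed

text \<open>Induction takes the place of Moebius inversion: both sides have the same sum over the
  divisors of \<open>q\<close>, and they agree at all proper divisors, hence at
  \<open>q\<close>.\<close>

lemma cohen_ramanujan_sum_squarefree:
  fixes n q s :: nat
  assumes s: "s > 0" and n: "n > 0" and "squarefree q"
  shows "cohen_ramanujan_sum s q (int (n ^ s)) =
    (\<Prod>p\<in>prime_factors q. if p dvd n then of_nat p ^ s - 1 else - 1)"
  using \<open>squarefree q\<close>
proof (induction q rule: less_induct)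
  case (less q)
  let ?c = "\<lambda>d. cohen_ramanujan_sum s d (int (n ^ s))"
  let ?G = "\<lambda>p. if p dvd n then of_nat p ^ s - 1 else - 1 :: complex"
  have q: "q > 0" using less.prems by (metis not_squarefree_0 Nat.gr0I)
  have "(\<Sum>d | d dvd q. ?c d) = (if q ^ s dvd n ^ s then of_nat (q ^ s) else 0)"
    using sum_roots_of_unity_powers[of "q ^ s" "n ^ s"] q
    by (simp add: sum_divisors_cohen_ramanujan_sum[OF s q])
  \<comment> \<open>The factor \<open>1 + ?G p\<close> is \<open>p ^ s\<close> if \<open>p\<close>
    divides \<open>n\<close> and \<open>0\<close> otherwise.\<close>
  also have "\<dots> = (\<Prod>p\<in>prime_factors q. 1 + ?G p)"
  proof (cases "q dvd n")
    case True
    then have "(\<Prod>p\<in>prime_factors q. 1 + ?G p) = (\<Prod>p\<in>prime_factors q. of_nat p ^ s)"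
      by (intro prod.cong refl) (auto dest: dvd_trans)
    also have "\<dots> = of_nat (\<Prod>(prime_factors q)) ^ s"
      by (simp add: prod_power_distrib)
    also have "\<dots> = of_nat (q ^ s)"
      using less.prems by (simp add: prod_prime_factors_squarefree)
    finally show ?thesis using True s by simp
  next
    case False
    \<comment> \<open>Otherwise the squarefree \<open>q\<close> would divide the product of the
      distinct primes of \<open>n\<close>, and so \<open>n\<close> itself.\<close>
    have "\<exists>p\<in>prime_factors q. \<not> p dvd n"
    proof (rule ccontr)
      assume "\<not> ?thesis"
      then have "prime_factors q \<subseteq> prime_factors n"
        using n by (auto simp: prime_factors_dvd)
      then have "\<Prod>(prime_factors q) dvd \<Prod>(prime_factors n)"
        by (intro prod_dvd_prod_subset) auto
      also have "\<dots> dvd (\<Prod>p\<in>prime_factors n. p ^ multiplicity p n)"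
        by (intro prod_dvd_prod dvd_power) (auto simp: prime_factors_multiplicity)
      also have "\<dots> = n" using n prod_prime_factors[of n] by simp
      finally show False using False less.prems by (simp add: prod_prime_factors_squarefree)
    qed
    then have "(\<Prod>p\<in>prime_factors q. 1 + ?G p) = 0" by (auto intro!: prod_zero)
    then show ?thesis using False s by simp
  qed
  also have "\<dots> = (\<Sum>d | d dvd q. \<Prod>p\<in>prime_factors d. ?G p)"
    unfolding divisors_squarefree[OF less.prems] by (rule sum_squarefree_prod[symmetric]) auto
  finally have eq: "(\<Sum>d | d dvd q. ?c d) = (\<Sum>d | d dvd q. \<Prod>p\<in>prime_factors d. ?G p)" .
  have "(\<Sum>d\<in>{d. d dvd q} - {q}. ?c d) = (\<Sum>d\<in>{d. d dvd q} - {q}. \<Prod>p\<in>prime_factors d. ?G p)"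
  proof (intro sum.cong refl less.IH)
    fix d assume "d \<in> {d. d dvd q} - {q}"
    then show "d < q" "squarefree d"
      using q less.prems by (auto dest: dvd_imp_le intro: squarefree_mono)
  qed
  with eq show ?case
    using q by (simp add: sum.remove[of "{d. d dvd q}" q])
qed

section \<open>Jordan totients and zeta values at integers\<close>

lemma jordan_totient_squarefree:
  assumes "squarefree q"
  shows "jordan_totient t q = (\<Prod>p\<in>prime_factors q. real p ^ t - 1)"
proof -
  have "real q ^ t = (\<Prod>p\<in>prime_factors q. real p ^ t)"
    using arg_cong[OF prod_prime_factors_squarefree[OF assms], of "\<lambda>x. real x ^ t"]
    by (simp add: prod_power_distrib)
  then have "jordan_totient t q = (\<Prod>p\<in>prime_factors q. real p ^ t * (1 - 1 / real p ^ t))"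
    by (simp add: jordan_totient_def prod.distrib)
  also have "\<dots> = (\<Prod>p\<in>prime_factors q. real p ^ t - 1)"
    by (intro prod.cong refl) (auto simp: right_diff_distrib prime_gt_0_nat dest: in_prime_factors_imp_prime)
  finally show ?thesis .
qed

text \<open>Links the complex \<open>powr\<close> series to the real series of the Euler product;
  for these exponents the series converges.\<close>

lemma riemann_zeta_of_nat:
  assumes "t \<ge> 2"
  shows "riemann_zeta (of_nat t) = of_real (\<Sum>m. 1 / real (Suc m) ^ t)"
proof -
  have "summable (\<lambda>m. 1 / real m ^ t)"
    using inverse_power_summable[OF assms, where ?'a = real] by (simp add: field_simps)
  then have "summable (\<lambda>m. 1 / real (Suc m) ^ t)" by (subst summable_Suc_iff)
  from suminf_of_real[OF this, where ?'a = complex] show ?thesis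
    by (simp add: riemann_zeta_def powr_nat' del: of_nat_Suc)
qed

section \<open>Local factors and summation of the series\<close>

theorem theorem1p1:
  fixes s k n :: nat
  assumes "s > 0" and "k > 0" and "n > 0"
  shows "(\<lambda>i. let q = Suc i in
            of_int (moebius_mu q) / of_real (jordan_totient (s + k) q)
              * cohen_ramanujan_sum s q (int (n ^ s)))
         sums (of_real (jordan_totient k n) / of_nat (n ^ k) * riemann_zeta (of_nat (s + k)))"
proof -
  define t where "t = s + k"
  have t: "t \<ge> 2" using assms by (simp add: t_def)
  \<comment> \<open>For prime \<open>p\<close>, \<open>G p\<close> is the Cohen-Ramanujan sum at
    \<open>p\<close> and \<open>a p\<close> the term of the series there, its minus sign being the
    Moebius value.\<close>
  define G where "G p = (if p dvd n then real p ^ s - 1 else - 1)" for p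
  define a where "a p = - G p / (real p ^ t - 1)" for p
  define Z where "Z = (\<Sum>m. 1 / real (Suc m) ^ t)"
  define J where "J = (\<Prod>p\<in>prime_factors n. 1 - 1 / real p ^ k)"
  define g where "g q = (if squarefree q then \<Prod>p\<in>prime_factors q. a p else 0)" for q
  have "summable (\<lambda>p. \<bar>a p\<bar>)"
  proof (rule summable_comparison_test')
    \<comment> \<open>The bound combines \<open>\<bar>G p\<bar> \<le> n ^ s\<close> with
      \<open>p ^ t - 1 \<ge> p ^ t / 2\<close>; the latter holds since
      \<open>p ^ t \<ge> 2\<close>.\<close>
    show "summable (\<lambda>p. 2 * real n ^ s * inverse (real p ^ t))"
      using inverse_power_summable[OF t] by (rule summable_mult)
    fix p :: nat assume p: "p \<ge> 2"
    have "\<bar>G p\<bar> \<le> real n ^ s"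
    proof (cases "p dvd n")
      case True
      then have "real p ^ s \<le> real n ^ s" using assms by (simp add: dvd_imp_le power_mono)
      moreover have "1 \<le> real p ^ s" using p by simp
      ultimately show ?thesis using True by (simp add: G_def)
    qed (use assms in \<open>simp add: G_def\<close>)
    moreover have "real p ^ t \<ge> 2"
      using p t self_le_power[of "real p" t] by linarith
    ultimately have "\<bar>G p\<bar> / \<bar>real p ^ t - 1\<bar> \<le> real n ^ s / (real p ^ t / 2)"
      by (intro frac_le) linarith+
    also have "\<dots> = 2 * real n ^ s * inverse (real p ^ t)"
      by (simp add: field_simps)
    finally show "norm \<bar>a p\<bar> \<le> 2 * real n ^ s * inverse (real p ^ t)"
      by (simp add: a_def)
  qed
  moreover have "(\<lambda>N. \<Prod>p | prime p \<and> p \<le> N. 1 + a p) \<longlonglongrightarrow> J * Z"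
  proof -
    have factor: "1 + a p = (if p dvd n then 1 - 1 / real p ^ k else 1) * (1 / (1 - 1 / real p ^ t))"
      if "prime p" for p
    proof -
      \<comment> \<open>With \<open>p ^ t = x * y\<close>, the claim for \<open>p\<close> dividing
        \<open>n\<close> is that \<open>1 - (x - 1) / (x * y - 1)\<close> equals
        \<open>(x * y - x) / (x * y - 1)\<close>; otherwise it is
        \<open>1 + 1 / (x * y - 1) = x * y / (x * y - 1)\<close>.\<close>
      define x y where "x = real p ^ s" and "y = real p ^ k"
      have "x > 1" "y > 1"
        unfolding x_def y_def using prime_power_gt_1[OF that] assms by auto
      moreover from this have "x * y > 1" by (rule less_1_mult)
      moreover have "real p ^ t = x * y" by (simp add: x_def y_def t_def power_add)
      ultimately show ?thesis
        by (auto simp: a_def G_def field_simps simp flip: x_def y_def)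
    qed
    \<comment> \<open>Every prime divisor of \<open>n\<close> is at most \<open>n\<close>, so from
      \<open>N = n\<close> on the correction factors are all present.\<close>
    have J: "(\<Prod>p | prime p \<and> p \<le> N. if p dvd n then 1 - 1 / real p ^ k else 1) = J" if "N \<ge> n" for N
      unfolding J_def using assms that
      by (intro prod.mono_neutral_cong_right)
         (auto simp: finite_primes_le prime_factors_dvd dest: dvd_imp_le)
    have "(\<lambda>N. J * (\<Prod>p | prime p \<and> p \<le> N. 1 / (1 - 1 / real p ^ t))) \<longlonglongrightarrow> J * Z"
      unfolding Z_def by (intro tendsto_intros euler_product_zeta_real t)
    moreover have "\<forall>\<^sub>F N in sequentially. J * (\<Prod>p | prime p \<and> p \<le> N. 1 / (1 - 1 / real p ^ t)) =
        (\<Prod>p | prime p \<and> p \<le> N. 1 + a p)"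
      using eventually_ge_at_top[of n]
    proof eventually_elim
      case (elim N)
      have "(\<Prod>p | prime p \<and> p \<le> N. 1 + a p) = (\<Prod>p | prime p \<and> p \<le> N.
          (if p dvd n then 1 - 1 / real p ^ k else 1) * (1 / (1 - 1 / real p ^ t)))"
        by (intro prod.cong refl) (simp add: factor)
      then show ?case by (simp only: prod.distrib J[OF elim])
    qed
    ultimately show ?thesis by (rule Lim_transform_eventually)
  qed
  ultimately have "((\<lambda>q. \<Prod>p\<in>prime_factors q. a p) has_sum J * Z) {q. squarefree q}"
    by (rule squarefree_has_sum_euler_product)
  then have "(g has_sum J * Z) UNIV"
    by (rule iffD1[OF has_sum_cong_neutral, rotated -1]) (auto simp: g_def)
  then have "g sums (J * Z)" by (rule has_sum_imp_sums)
  \<comment> \<open>As \<open>0\<close> is not squarefree, dropping it shifts the index to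
    \<open>q = Suc i\<close> without changing the sum.\<close>
  moreover have "g 0 = 0" by (simp add: g_def)
  ultimately have "(\<lambda>i. g (Suc i)) sums (J * Z)" by (simp add: sums_Suc_iff)
  then have "(\<lambda>i. complex_of_real (g (Suc i))) sums complex_of_real (J * Z)"
    by (rule sums_of_real)
  moreover have "complex_of_real (g q) = of_int (moebius_mu q) / of_real (jordan_totient (s + k) q)
      * cohen_ramanujan_sum s q (int (n ^ s))" for q
  proof (cases "squarefree q")
    case True
    have "cohen_ramanujan_sum s q (int (n ^ s)) = of_real (\<Prod>p\<in>prime_factors q. G p)"
      unfolding cohen_ramanujan_sum_squarefree[OF assms(1,3) True] of_real_prod
      by (intro prod.cong refl) (simp add: G_def)
    \<comment> \<open>Collecting the minus signs of the factors \<open>a p\<close> produces the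
      Moebius value of \<open>q\<close>.\<close>
    moreover have "g q = (-1) ^ card (prime_factors q) / jordan_totient (s + k) q
        * (\<Prod>p\<in>prime_factors q. G p)"
      using True unfolding g_def a_def jordan_totient_squarefree[OF True] t_def
      by (simp add: prod_dividef prod_uminus)
    ultimately show ?thesis using True by (simp add: moebius_mu_def)
  qed (simp add: g_def moebius_mu_def)
  moreover have "complex_of_real (J * Z) =
      of_real (jordan_totient k n) / of_nat (n ^ k) * riemann_zeta (of_nat (s + k))"
    using assms riemann_zeta_of_nat[OF t] by (simp add: jordan_totient_def J_def Z_def t_def)
  ultimately show ?thesis by (simp add: Let_def)
qed

end
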